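(* There exists a finite dimensional asymmetric normed space $(X,q)$ such that the closed unit ball $B_1^q[0]$ is right bounded and is not compact (in the topology $\tau_q$).
   Context: An asymmetric norm on a real linear space $X$ is a function $q:X\to[0,\infty)$ such that (i) $q(ax)=a\,q(x)$ for all $x\in X$, $a\ge 0$; (ii) $q(x+y)\le q(x)+q(y)$ for all $x,y\in X$; (iii) if $q(x)=q(-x)=0$ then $x=0$. The pair $(X,q)$ is an asymmetric normed space. The topology $\tau_q$ is generated by the open balls $B^q_\varepsilon(x)=\{y\in X: q(y-x)<\varepsilon\}$. The closed ball is $B^q_\varepsilon[x]=\{y\in X: q(y-x)\le\varepsilon\}$. Let $\theta_q=\{x\in X: q(x)=0\}$ and let $q^s(x)=\max\{q(x),q(-x)\}$, which is a norm on $X$; $B_\varepsilon^{q^s}[x]$ denotes its closed balls. $q$ is right bounded (one also says that $B_1^q[0]$ is right bounded) if there is $r>0$ with $rB_1^q[0]\subset B_1^{q^s}[0]+\theta_q$. *)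

theory Defs
  imports "HOL-Analysis.Analysis" "HOL-Analysis.Finite_Function_Topology"
begin

text \<open>
  The real linear space is a linear subspace X of some type of class real_vector. The values
  of q outside X play no role.
\<close>

locale asymmetric_normed_space =
  fixes X :: "'a::real_vector set" and q :: "'a \<Rightarrow> real"
  assumes subspace: "subspace X"
    and nonneg: "x \<in> X \<Longrightarrow> 0 \<le> q x"
    and homogeneous: "x \<in> X \<Longrightarrow> 0 \<le> a \<Longrightarrow> q (a *\<^sub>R x) = a * q x"
    and triangle: "x \<in> X \<Longrightarrow> y \<in> X \<Longrightarrow> q (x + y) \<le> q x + q y"
    and definite: "x \<in> X \<Longrightarrow> q x = 0 \<Longrightarrow> q (- x) = 0 \<Longrightarrow> x = 0"

definition asym_ball :: "'a::real_vector set \<Rightarrow> ('a \<Rightarrow> real) \<Rightarrow> 'a \<Rightarrow> real \<Rightarrow> 'a set"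
  where "asym_ball X q x e = {y \<in> X. q (y - x) < e}"

definition asym_cball :: "'a::real_vector set \<Rightarrow> ('a \<Rightarrow> real) \<Rightarrow> 'a \<Rightarrow> real \<Rightarrow> 'a set"
  where "asym_cball X q x e = {y \<in> X. q (y - x) \<le> e}"

definition asym_topology :: "'a::real_vector set \<Rightarrow> ('a \<Rightarrow> real) \<Rightarrow> 'a topology"
  where "asym_topology X q = topology_generated_by {asym_ball X q x e | x e. x \<in> X \<and> 0 < e}"

definition null_cone :: "'a::real_vector set \<Rightarrow> ('a \<Rightarrow> real) \<Rightarrow> 'a set"
  where "null_cone X q = {x \<in> X. q x = 0}"

definition sym_norm :: "('a::real_vector \<Rightarrow> real) \<Rightarrow> 'a \<Rightarrow> real"
  where "sym_norm q x = max (q x) (q (- x))"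

definition right_bounded :: "'a::real_vector set \<Rightarrow> ('a \<Rightarrow> real) \<Rightarrow> bool"
  where "right_bounded X q \<longleftrightarrow>
    (\<exists>r>0. (\<lambda>x. r *\<^sub>R x) ` asym_cball X q 0 1 \<subseteq> asym_cball X (sym_norm q) 0 1 + null_cone X q)"

definition finite_dimensional :: "'a::real_vector set \<Rightarrow> bool"
  where "finite_dimensional X \<longleftrightarrow> (\<exists>B. finite B \<and> X = span B)"

text \<open>
  Existence of a finite-dimensional space cannot be expressed by quantifying over types. The
  lemma below shows that quantifying over the finite-dimensional subspaces of the finitely
  supported sequences loses no space: every finite-dimensional subspace of any real vector
  space embeds there linearly.
\<close>

lemma finite_dimensional_embeds:
  fixes X :: "'a::real_vector set"
  assumes "finite_dimensional X"
  shows "\<exists>f :: 'a \<Rightarrow> (nat \<Rightarrow>\<^sub>0 real). linear f \<and> inj_on f X \<and> finite_dimensional (f ` X)"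
proof -
  from assms obtain C where C: "finite C" "X = span C"
    unfolding finite_dimensional_def by blast
  obtain B where B: "B \<subseteq> C" "independent B" "C \<subseteq> span B"
    by (rule maximal_independent_subset)
  have fin: "finite B"
    using B(1) C(1) by (rule finite_subset)
  have X: "X = span B"
    using B C by (metis span_eq span_superset subset_trans)
  obtain g :: "'a \<Rightarrow> nat" where g: "inj_on g B"
    using fin finite_imp_inj_to_nat_seg by blast
  obtain f :: "'a \<Rightarrow> (nat \<Rightarrow>\<^sub>0 real)" where f: "linear f"
    "\<forall>b\<in>B. f b = Poly_Mapping.single (g b) 1"
    using linear_independent_extend[OF B(2), of "\<lambda>b. Poly_Mapping.single (g b) 1"] by auto
  have "x = 0" if x: "x \<in> span B" and fx: "f x = 0" for x
  proof -
    obtain u where u: "x = (\<Sum>b\<in>B. u b *\<^sub>R b)"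
      using x span_finite[OF fin] by auto
    have "u c = 0" if c: "c \<in> B" for c
    proof -
      have "f x = (\<Sum>b\<in>B. u b *\<^sub>R Poly_Mapping.single (g b) 1)"
        using f by (simp add: u linear_sum linear_scale)
      hence "0 = Poly_Mapping.lookup (\<Sum>b\<in>B. u b *\<^sub>R Poly_Mapping.single (g b) (1::real)) (g c)"
        using fx by simp
      also have "\<dots> = (\<Sum>b\<in>B. if b = c then u b else 0)"
        unfolding lookup_sum
      proof (rule sum.cong[OF refl])
        fix b assume "b \<in> B"
        with g c have "g b = g c \<longleftrightarrow> b = c"
          by (auto dest: inj_onD)
        thus "Poly_Mapping.lookup (u b *\<^sub>R Poly_Mapping.single (g b) (1::real)) (g c)
            = (if b = c then u b else 0)"
          by (auto simp: scaleR_poly_mapping_def lookup_single when_def)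
      qed
      finally show ?thesis
        using fin c by simp
    qed
    thus ?thesis
      by (simp add: u)
  qed
  hence "inj_on f X"
    unfolding X using linear_injective_on_subspace_0[OF f(1)] by (metis subspace_span)
  moreover have "finite_dimensional (f ` X)"
    unfolding finite_dimensional_def X
    using linear_span_image[OF f(1), of B] fin by (metis finite_imageI)
  ultimately show ?thesis
    using f(1) by blast
qed

lemma (in asymmetric_normed_space) topspace_asym_topology: "topspace (asym_topology X q) = X"
proof -
  have "q 0 = 0"
    using homogeneous[of 0 0] subspace by (simp add: subspace_0)
  hence "x \<in> asym_ball X q x 1" if "x \<in> X" for x
    using that by (simp add: asym_ball_def)
  hence "X \<subseteq> \<Union>{asym_ball X q x e | x e. x \<in> X \<and> 0 < e}"
    using zero_less_one by blast
  thus ?thesis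
    unfolding asym_topology_def topology_generated_by_topspace
    by (auto simp: asym_ball_def)
qed

end

theory Submission
  imports Defs
begin

text \<open>
  The example lives in the plane, with
  \<open>q (x, y) = max \<bar>x\<bar> (x + y + sqrt (x\<^sup>2 + y\<^sup>2))\<close>. The inequality
  \<open>x + y + sqrt (x\<^sup>2 + y\<^sup>2) \<le> 1\<close> describes the region \<open>(1 - x) (1 - y) \<ge> 1/2\<close> below and to
  the left of one branch of a hyperbola with the asymptote \<open>x = 1\<close>, so the closed unit ball
  is the part of that region in the strip \<open>- 1 \<le> x \<le> 1\<close>, and the null cone is the downward
  ray \<open>x = 0\<close>, \<open>y \<le> 0\<close>.

  Right boundedness asks only that the ball be bounded modulo the null cone, that is,
  bounded in \<open>x\<close> and bounded above in \<open>y\<close>, and this holds. It puts no lower bound on the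
  boundary of the ball: the ball approaches the line \<open>x = 1\<close> by escaping downwards, so the
  coordinate \<open>x\<close> does not attain its supremum on it. Since \<open>\<bar>x\<bar> \<le> q (x, y)\<close>, the half
  planes \<open>x < a\<close> are open for the topology of \<open>q\<close>, and those with \<open>a < 1\<close> form an open cover of
  the ball without finite subcover.
\<close>

section \<open>Suprema that are not attained\<close>

text \<open>
  An upper semicontinuous function attains its maximum on a nonempty compact set; this is the
  contrapositive.
\<close>

lemma not_compactin_if_no_maximum:
  fixes f :: "'a \<Rightarrow> 'b::linorder"
  assumes opn: "\<And>a. openin T {p \<in> topspace T. f p < a}"
    and sub: "S \<subseteq> topspace T" and ne: "S \<noteq> {}"
    and no_max: "\<And>p. p \<in> S \<Longrightarrow> \<exists>p'\<in>S. f p < f p'"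
  shows "\<not> compactin T S"
proof
  assume "compactin T S"
  moreover have "S \<subseteq> (\<Union>s\<in>S. {p \<in> topspace T. f p < f s})"
    using sub no_max by blast
  ultimately obtain \<F> where \<F>: "finite \<F>" "\<F> \<subseteq> (\<lambda>s. {p \<in> topspace T. f p < f s}) ` S"
    "S \<subseteq> \<Union>\<F>"
    using compactinD[of T S "(\<lambda>s. {p \<in> topspace T. f p < f s}) ` S"] opn by auto
  from finite_subset_image[OF \<F>(1,2)] \<F>(3)
  obtain F where F: "finite F" "F \<subseteq> S" "S \<subseteq> (\<Union>s\<in>F. {p \<in> topspace T. f p < f s})"
    by auto
  have "F \<noteq> {}"
    using F(3) ne by auto
  have "Max (f ` F) \<in> f ` F"
    using F(1) \<open>F \<noteq> {}\<close> by (intro Max_in) auto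
  then obtain m where m: "m \<in> F" "f m = Max (f ` F)"
    by auto
  with F(2,3) obtain s where s: "s \<in> F" "f m < f s"
    by blast
  moreover have "f s \<le> Max (f ` F)"
    using F(1) s(1) by (intro Max_ge) auto
  ultimately show False
    using m(2) by simp
qed

section \<open>The gauge of the region on one side of a hyperbola\<close>

definition hyp_gauge :: "real \<Rightarrow> real \<Rightarrow> real"
  where "hyp_gauge x y = max \<bar>x\<bar> (x + y + sqrt (x\<^sup>2 + y\<^sup>2))"

lemma hyp_gauge_scale:
  assumes "0 \<le> a"
  shows "hyp_gauge (a * x) (a * y) = a * hyp_gauge x y"
proof -
  have "sqrt ((a * x)\<^sup>2 + (a * y)\<^sup>2) = a * sqrt (x\<^sup>2 + y\<^sup>2)"
    using assms by (simp add: power_mult_distrib real_sqrt_mult flip: distrib_left)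
  thus ?thesis
    using assms by (simp add: hyp_gauge_def max_mult_distrib_left abs_mult distrib_left)
qed

lemma hyp_gauge_triangle: "hyp_gauge (x + x') (y + y') \<le> hyp_gauge x y + hyp_gauge x' y'"
  using real_sqrt_sum_squares_triangle_ineq[of x x' y y'] by (auto simp: hyp_gauge_def)

lemma hyp_gauge_eq_0_iff: "hyp_gauge x y = 0 \<longleftrightarrow> x = 0 \<and> y \<le> 0"
  by (auto simp: hyp_gauge_def max_def)

lemma hyp_gauge_le_1D:
  assumes "hyp_gauge x y \<le> 1"
  shows "\<bar>x\<bar> \<le> 1" "x < 1" "y \<le> 1"
proof -
  have h: "\<bar>x\<bar> \<le> 1" "x + y + sqrt (x\<^sup>2 + y\<^sup>2) \<le> 1"
    using assms by (auto simp: hyp_gauge_def)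
  show "\<bar>x\<bar> \<le> 1"
    by fact
  have "\<bar>x\<bar> \<le> sqrt (x\<^sup>2 + y\<^sup>2)"
    by (rule real_le_rsqrt) simp
  with h show "y \<le> 1"
    by linarith
  have "\<bar>y\<bar> < sqrt (1 + y\<^sup>2)"
    by (rule real_less_rsqrt) simp
  with h show "x < 1"
    by (cases "x = 1") auto
qed

lemma hyp_gauge_le_1I:
  assumes "\<bar>x\<bar> \<le> 1" "x + y \<le> 1" "1 \<le> 2 * ((1 - x) * (1 - y))"
  shows "hyp_gauge x y \<le> 1"
proof -
  have "x\<^sup>2 + y\<^sup>2 \<le> (1 - x - y)\<^sup>2"
    using assms(3) by (simp add: power2_eq_square algebra_simps)
  hence "sqrt (x\<^sup>2 + y\<^sup>2) \<le> 1 - x - y"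
    using assms(2) by (intro real_le_lsqrt) auto
  thus ?thesis
    using assms(1) by (simp add: hyp_gauge_def)
qed

lemma hyp_gauge_crude_bound: "hyp_gauge x y \<le> 2 * \<bar>x\<bar> + 2 * \<bar>y\<bar>"
  using sqrt_sum_squares_le_sum_abs[of x y] by (simp add: hyp_gauge_def)

lemma hyp_gauge_ball_no_rightmost:
  assumes "hyp_gauge x y \<le> 1"
  shows "\<exists>x' y'. hyp_gauge x' y' \<le> 1 \<and> x < x'"
proof -
  define x' where "x' = (1 + max x 0) / 2"
  \<comment> \<open>the point of the hyperbola with abscissa \<open>x'\<close>; it lies on the correct branch because
    \<open>x' < 1\<close>, and \<open>y' \<le> 0\<close> because \<open>1/2 \<le> x'\<close>\<close>
  define y' where "y' = 1 - 1 / (2 * (1 - x'))"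
  have x': "1 / 2 \<le> x'" "x' < 1" "x < x'"
    using hyp_gauge_le_1D[OF assms] by (auto simp: x'_def max_def)
  have "y' \<le> 0"
    using x' by (simp add: y'_def field_simps)
  moreover have "(1 - x') * (1 - y') = 1 / 2"
    using x' by (simp add: y'_def)
  ultimately have "hyp_gauge x' y' \<le> 1"
    using x' by (intro hyp_gauge_le_1I) auto
  with x'(3) show ?thesis
    by blast
qed

section \<open>The plane inside the finitely supported sequences\<close>

definition vec2 :: "real \<Rightarrow> real \<Rightarrow> (nat \<Rightarrow>\<^sub>0 real)"
  where "vec2 x y = x *\<^sub>R Poly_Mapping.single 0 1 + y *\<^sub>R Poly_Mapping.single 1 1"

definition plane :: "(nat \<Rightarrow>\<^sub>0 real) set"
  where "plane = span {Poly_Mapping.single 0 1, Poly_Mapping.single 1 1}"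

definition plane_gauge :: "(nat \<Rightarrow>\<^sub>0 real) \<Rightarrow> real"
  where "plane_gauge p = hyp_gauge (Poly_Mapping.lookup p 0) (Poly_Mapping.lookup p 1)"

lemma lookup_scaleR: "Poly_Mapping.lookup (a *\<^sub>R p) i = a * Poly_Mapping.lookup p i"
  for p :: "nat \<Rightarrow>\<^sub>0 real"
  by (simp add: scaleR_poly_mapping_def)

lemma lookup_vec2 [simp]:
  "Poly_Mapping.lookup (vec2 x y) 0 = x" "Poly_Mapping.lookup (vec2 x y) (Suc 0) = y"
  by (simp_all add: vec2_def lookup_add lookup_scaleR lookup_single lookup_one)

lemma vec2_in_plane [simp]: "vec2 x y \<in> plane"
  unfolding vec2_def plane_def by (intro span_add span_scale span_base) auto

lemma plane_cases:
  assumes "p \<in> plane"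
  obtains x y where "p = vec2 x y"
  using assms by (auto simp: plane_def span_insert vec2_def algebra_simps)

lemma vec2_arith:
  "vec2 x y + vec2 x' y' = vec2 (x + x') (y + y')" "- vec2 x y = vec2 (- x) (- y)"
  "a *\<^sub>R vec2 x y = vec2 (a * x) (a * y)" "vec2 0 0 = 0"
  by (simp_all add: vec2_def algebra_simps)

lemma plane_gauge_vec2 [simp]: "plane_gauge (vec2 x y) = hyp_gauge x y"
  by (simp add: plane_gauge_def)

interpretation plane: asymmetric_normed_space plane plane_gauge
proof
  show "subspace plane"
    by (simp add: plane_def)
next
  fix p assume "p \<in> plane" "plane_gauge p = 0" "plane_gauge (- p) = 0"
  thus "p = 0"
    by (auto elim!: plane_cases simp: vec2_arith hyp_gauge_eq_0_iff)
qed (auto elim!: plane_cases simp: vec2_arith hyp_gauge_scale hyp_gauge_triangle,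
     simp add: hyp_gauge_def)

lemma right_bounded_plane: "right_bounded plane plane_gauge"
  unfolding right_bounded_def
proof (intro exI[of _ "1/4"] conjI image_subsetI)
  fix p assume "p \<in> asym_cball plane plane_gauge 0 1"
  then obtain x y where p: "p = vec2 x y" "hyp_gauge x y \<le> 1"
    by (auto simp: asym_cball_def elim!: plane_cases)
  note b = hyp_gauge_le_1D[OF p(2)]
  \<comment> \<open>slide the point along the null cone up to the height \<open>1/4\<close>, where the ball of the
    symmetrized norm is wide enough\<close>
  have "(1/4) *\<^sub>R p = vec2 (x/4) (1/4) + vec2 0 ((y - 1) / 4)"
    by (simp add: p vec2_arith diff_divide_distrib)
  moreover have "vec2 (x/4) (1/4) \<in> asym_cball plane (sym_norm plane_gauge) 0 1"
    using b(1) hyp_gauge_crude_bound[of "x/4" "1/4"] hyp_gauge_crude_bound[of "- (x/4)" "- (1/4)"]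
    by (simp add: asym_cball_def sym_norm_def vec2_arith)
  moreover have "vec2 0 ((y - 1) / 4) \<in> null_cone plane plane_gauge"
    using b(3) by (simp add: null_cone_def hyp_gauge_eq_0_iff)
  ultimately show "(1/4) *\<^sub>R p \<in> asym_cball plane (sym_norm plane_gauge) 0 1
      + null_cone plane plane_gauge"
    by (metis set_plus_intro)
qed simp

text \<open>
  Around a point with first coordinate \<open>x < a\<close>, the ball of radius \<open>a - x\<close> stays inside the
  half plane, because the gauge dominates the first coordinate.
\<close>

lemma openin_half_plane:
  "openin (asym_topology plane plane_gauge) {p \<in> plane. Poly_Mapping.lookup p 0 < a}"
  (is "openin _ ?H")
proof -
  let ?B = "\<lambda>p. asym_ball plane plane_gauge p (a - Poly_Mapping.lookup p 0)"
  have "?B p \<subseteq> ?H" for p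
    by (auto simp: asym_ball_def plane_gauge_def hyp_gauge_def lookup_minus)
  moreover have "p \<in> ?B p" if "p \<in> ?H" for p
    using that by (simp add: asym_ball_def plane_gauge_def hyp_gauge_def)
  ultimately have H: "?H = (\<Union>p\<in>?H. ?B p)"
    by blast
  have "openin (asym_topology plane plane_gauge) (?B p)" if "p \<in> ?H" for p
    unfolding asym_topology_def
    by (rule topology_generated_by_Basis, rule CollectI, intro exI conjI, rule refl)
       (use that in simp_all)
  hence "openin (asym_topology plane plane_gauge) (\<Union>p\<in>?H. ?B p)"
    by (intro openin_Union) blast
  thus ?thesis
    by (subst H)
qed

lemma not_compactin_plane_ball:
  "\<not> compactin (asym_topology plane plane_gauge) (asym_cball plane plane_gauge 0 1)"
proof (rule not_compactin_if_no_maximum[where f = "\<lambda>p. Poly_Mapping.lookup p 0"])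
  have "vec2 0 0 \<in> asym_cball plane plane_gauge 0 1"
    by (simp add: asym_cball_def hyp_gauge_def)
  thus "asym_cball plane plane_gauge 0 1 \<noteq> {}"
    by blast
next
  fix p assume "p \<in> asym_cball plane plane_gauge 0 1"
  then obtain x y where p: "p = vec2 x y" "hyp_gauge x y \<le> 1"
    by (auto simp: asym_cball_def elim!: plane_cases)
  then obtain x' y' where "hyp_gauge x' y' \<le> 1" "x < x'"
    using hyp_gauge_ball_no_rightmost by blast
  thus "\<exists>p'\<in>asym_cball plane plane_gauge 0 1. Poly_Mapping.lookup p 0 < Poly_Mapping.lookup p' 0"
    by (intro bexI[of _ "vec2 x' y'"]) (simp_all add: p asym_cball_def)
qed (auto simp: plane.topspace_asym_topology openin_half_plane asym_cball_def)

theorem mainTheorem2: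
  shows "\<exists>(X :: (nat \<Rightarrow>\<^sub>0 real) set) (q :: (nat \<Rightarrow>\<^sub>0 real) \<Rightarrow> real).
           finite_dimensional X \<and> asymmetric_normed_space X q \<and>
           right_bounded X q \<and>
           \<not> compactin (asym_topology X q) (asym_cball X q 0 1)"
proof (intro exI conjI)
  show "finite_dimensional plane"
    unfolding finite_dimensional_def
    using plane_def finite.emptyI finite.insertI by metis
qed (fact plane.asymmetric_normed_space_axioms right_bounded_plane not_compactin_plane_ball)+

end
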